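(* Let $n$ and $q>1$ be positive integers. Let $p\geq q$ be a prime, and assume that $n\not\equiv 0 \pmod p$. Let $\mathcal{H}\subseteq \{0,1,\ldots,q-1\}^n\subseteq \mathbb{F}_p^n$ be a set of vectors such that there exists a positive integer $\lambda\not\equiv 0 \pmod p$ with $d_H(\mathbf{h},\mathbf{g})\equiv \lambda \pmod p$ for each pair of distinct $\mathbf{h},\mathbf{g}\in \mathcal{H}$. Suppose further that $q\lambda \not\equiv n(q-1)+1 \pmod p$. Then $|\mathcal{H}|\leq n(q-1)$.
   Context: For vectors $\mathbf{h}_1,\mathbf{h}_2\in\{0,1,\ldots,q-1\}^n$, the Hamming distance is $d_H(\mathbf{h}_1,\mathbf{h}_2):=|\{i\in \{1,\ldots,n\}:~ (\mathbf{h}_1)_i\neq (\mathbf{h}_2)_i\}|$. *)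

theory Defs
  imports Complex_Main "HOL-Library.FuncSet" "HOL-Number_Theory.Number_Theory"
begin

text \<open>
  Vectors of length \<open>n\<close> are extensional functions on \<open>{1..n}\<close>, so that distinct vectors differ
  in some coordinate and words over the alphabet \<open>{0, \<dots>, q - 1}\<close> form \<open>{1..n} \<rightarrow>\<^sub>E {0..<q}\<close>.
\<close>

definition hamming_dist :: "nat \<Rightarrow> (nat \<Rightarrow> 'a) \<Rightarrow> (nat \<Rightarrow> 'a) \<Rightarrow> nat" where
  "hamming_dist n h g = card {i \<in> {1..n}. h i \<noteq> g i}"

end

theory Submission
  imports Defs
begin

text \<open>
  For \<open>h \<in> H\<close> let \<open>f\<^sub>h(x) = \<lambda> - d\<^sub>H(h, x)\<close>. Modulo \<open>p\<close>, these functions form \<open>\<lambda>\<close> times the identity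
  matrix on \<open>H\<close>, hence they are independent, and they lie in the space of functions
  \<open>x \<mapsto> \<Sum>\<^sub>i g\<^sub>i(x\<^sub>i)\<close>, which has dimension \<open>n (q - 1) + 1\<close>. If \<open>H\<close> has exactly that many elements,
  then every indicator function \<open>x \<mapsto> [x\<^sub>i = a]\<close> is a combination of the \<open>f\<^sub>h\<close>; evaluation on \<open>H\<close>
  determines the coefficients, which gives \<open>\<lambda> [x\<^sub>i = a] \<equiv> \<Sum>\<^sub>h [h\<^sub>i = a] f\<^sub>h(x)\<close> for all words \<open>x\<close>.
  Changing the letter \<open>x\<^sub>i\<close> from \<open>a\<close> to another one shows that the number of \<open>h \<in> H\<close> with \<open>h\<^sub>i = a\<close>
  is \<open>\<lambda>\<close> modulo \<open>p\<close>. Summation over \<open>a\<close> gives \<open>q \<lambda> \<equiv> |H| = n (q - 1) + 1\<close>, which is excluded.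
\<close>

text \<open>Pigeonhole principle: there are p^|J| coefficient families with values in
  \<open>{0..<int p}\<close>, but only p^|Z| families of residues on \<open>Z\<close>. Two
  coefficient families collide, and their difference is the relation.\<close>

lemma nontrivial_relation_mod:
  fixes f :: "'a \<Rightarrow> 'b \<Rightarrow> int" and p :: nat
  assumes "finite J" "finite Z" "card Z < card J" "p > 1"
  shows "\<exists>c. (\<exists>j\<in>J. \<not> int p dvd c j) \<and> (\<forall>z\<in>Z. int p dvd (\<Sum>j\<in>J. c j * f j z))"
proof -
  define A where "A = (J \<rightarrow>\<^sub>E {0..<int p})"
  define B where "B = (Z \<rightarrow>\<^sub>E {0..<int p})"
  define T where "T = (\<lambda>c. \<lambda>z\<in>Z. (\<Sum>j\<in>J. c j * f j z) mod int p)"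
  have "T ` A \<subseteq> B" "finite B" "card B < card A"
    using assms by (auto simp: A_def B_def T_def card_PiE finite_PiE)
  then have "\<not> inj_on T A"
    by (metis card_inj_on_le linorder_not_le)
  then obtain c d where cd: "c \<in> A" "d \<in> A" "T c = T d" "c \<noteq> d"
    by (auto simp: inj_on_def)
  show ?thesis
  proof (intro exI[of _ "\<lambda>j. c j - d j"] conjI ballI)
    obtain j where j: "j \<in> J" "c j \<noteq> d j"
      using cd unfolding A_def by (meson PiE_ext)
    then have "c j \<in> {0..<int p}" "d j \<in> {0..<int p}"
      using cd unfolding A_def by auto
    \<comment> \<open>Both values are reduced residues, so distinct means incongruent.\<close>
    then have "\<not> int p dvd c j - d j"
      using j by (metis atLeastLessThan_iff mod_eq_dvd_iff mod_pos_pos_trivial)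
    then show "\<exists>j\<in>J. \<not> int p dvd c j - d j"
      using j by blast
  next
    fix z assume "z \<in> Z"
    then have "(\<Sum>j\<in>J. c j * f j z) mod int p = (\<Sum>j\<in>J. d j * f j z) mod int p"
      using fun_cong[OF cd(3), of z] by (simp add: T_def)
    then show "int p dvd (\<Sum>j\<in>J. (c j - d j) * f j z)"
      by (simp add: mod_eq_dvd_iff left_diff_distrib sum_subtractf)
  qed
qed

lemma int_hamming_dist:
  "int (hamming_dist n h x) = (\<Sum>j=1..n. of_bool (h j \<noteq> x j))"
  by (simp add: hamming_dist_def sum.If_cases of_bool_def Int_def)

lemma int_card_Collect:
  "finite A \<Longrightarrow> int (card {x \<in> A. P x}) = (\<Sum>x\<in>A. of_bool (P x))"
  by (simp add: sum.If_cases of_bool_def Int_def)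

lemma hamming_dist_fun_upd:
  assumes "j \<in> {1..n}"
  shows "int (hamming_dist n h (z(j := b))) =
    int (hamming_dist n h z) + of_bool (h j \<noteq> b) - of_bool (h j \<noteq> z j)"
proof -
  have "(\<Sum>k\<in>{1..n}-{j}. of_bool (h k \<noteq> (z(j := b)) k)) =
        (\<Sum>k\<in>{1..n}-{j}. of_bool (h k \<noteq> z k) :: int)"
    by (rule sum.cong) auto
  then show ?thesis
    unfolding int_hamming_dist sum.remove[OF finite_atLeastAtMost assms] by simp
qed

text \<open>
  The functions of the form \<open>x \<mapsto> \<Sum>\<^sub>i g\<^sub>i(x\<^sub>i)\<close>, characterised by their values at the words
  of weight at most one; only \<open>n (q - 1) + 1\<close> of these words have letters below \<open>q\<close>.
\<close>

definition separable :: "nat \<Rightarrow> ((nat \<Rightarrow> nat) \<Rightarrow> int) \<Rightarrow> bool" where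
  "separable n F \<longleftrightarrow>
    (\<forall>x. F x = F (\<lambda>_. 0) + (\<Sum>j=1..n. F ((\<lambda>_. 0)(j := x j)) - F (\<lambda>_. 0)))"

lemma separable_sum:
  assumes "\<And>j. j \<in> J \<Longrightarrow> separable n (f j)"
  shows "separable n (\<lambda>x. \<Sum>j\<in>J. c j * f j x)"
  unfolding separable_def
proof
  fix x
  let ?z = "\<lambda>_::nat. 0::nat"
  have "c j * f j x = c j * f j ?z + (\<Sum>k=1..n. c j * f j (?z(k := x k)) - c j * f j ?z)"
    if "j \<in> J" for j
  proof -
    have "f j x = f j ?z + (\<Sum>k=1..n. f j (?z(k := x k)) - f j ?z)"
      using assms[OF that] unfolding separable_def by blast
    then have "c j * f j x = c j * (f j ?z + (\<Sum>k=1..n. f j (?z(k := x k)) - f j ?z))"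
      by (rule arg_cong)
    also have "\<dots> = c j * f j ?z + (\<Sum>k=1..n. c j * f j (?z(k := x k)) - c j * f j ?z)"
      by (simp only: distrib_left sum_distrib_left right_diff_distrib)
    finally show ?thesis .
  qed
  then have "(\<Sum>j\<in>J. c j * f j x) = (\<Sum>j\<in>J. c j * f j ?z) +
      (\<Sum>j\<in>J. \<Sum>k=1..n. c j * f j (?z(k := x k)) - c j * f j ?z)"
    by (simp only: sum.distrib cong: sum.cong)
  also have "(\<Sum>j\<in>J. \<Sum>k=1..n. c j * f j (?z(k := x k)) - c j * f j ?z) =
      (\<Sum>k=1..n. \<Sum>j\<in>J. c j * f j (?z(k := x k)) - c j * f j ?z)"
    by (rule sum.swap)
  finally show "(\<Sum>j\<in>J. c j * f j x) = (\<Sum>j\<in>J. c j * f j ?z) +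
      (\<Sum>k=1..n. (\<Sum>j\<in>J. c j * f j (?z(k := x k))) - (\<Sum>j\<in>J. c j * f j ?z))"
    by (simp only: sum_subtractf)
qed

lemma separable_hamming_dist: "separable n (\<lambda>x. l - int (hamming_dist n h x))"
  unfolding separable_def
proof
  fix x
  let ?z = "\<lambda>_::nat. 0::nat"
  have "(\<Sum>j=1..n. (l - int (hamming_dist n h (?z(j := x j)))) - (l - int (hamming_dist n h ?z))) =
        (\<Sum>j=1..n. of_bool (h j \<noteq> 0) - of_bool (h j \<noteq> x j))"
    by (intro sum.cong refl) (simp add: hamming_dist_fun_upd del: fun_upd_apply)
  then show "l - int (hamming_dist n h x) = l - int (hamming_dist n h ?z) +
      (\<Sum>j=1..n. (l - int (hamming_dist n h (?z(j := x j)))) - (l - int (hamming_dist n h ?z)))"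
    by (simp add: sum_subtractf int_hamming_dist)
qed

lemma separable_letter_indicator:
  assumes "i \<in> {1..n}"
  shows "separable n (\<lambda>x. of_bool (x i = a))"
  unfolding separable_def
proof
  fix x :: "nat \<Rightarrow> nat"
  let ?z = "\<lambda>_::nat. 0::nat"
  have "(\<Sum>j=1..n. of_bool ((?z(j := x j)) i = a) - of_bool (?z i = a)) =
        (\<Sum>j=1..n. if j = i then of_bool (x i = a) - of_bool (0 = a) else 0 :: int)"
    by (intro sum.cong refl) auto
  then show "of_bool (x i = a) = of_bool (?z i = a) +
      (\<Sum>j=1..n. of_bool ((?z(j := x j)) i = a) - of_bool (?z i = a) :: int)"
    using assms by simp
qed

text \<open>Separability propagates a relation from the zero word and the words with one nonzero
  letter to all words, and there are at most \<open>n * (q - 1) + 1\<close> such test words. They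
  are 0 outside \<open>{1..n}\<close>, hence \<open>\<rightarrow>\<close> instead of the extensional
  \<open>\<rightarrow>\<^sub>E\<close>.\<close>

lemma separable_relation_mod:
  fixes f :: "'a \<Rightarrow> (nat \<Rightarrow> nat) \<Rightarrow> int" and p :: nat
  assumes "finite J" "card J > n * (q - 1) + 1" "p > 1"
    and sep: "\<And>j. j \<in> J \<Longrightarrow> separable n (f j)"
  shows "\<exists>c. (\<exists>j\<in>J. \<not> int p dvd c j) \<and>
    (\<forall>x \<in> {1..n} \<rightarrow> {0..<q}. int p dvd (\<Sum>j\<in>J. c j * f j x))"
proof -
  let ?z = "\<lambda>_::nat. 0::nat"
  let ?W = "(\<lambda>(i, b). ?z(i := b)) ` ({1..n} \<times> {1..<q})"
  have "card ?W \<le> n * (q - 1)"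
    using card_image_le[of "{1..n} \<times> {1..<q}"] by (simp add: card_cartesian_product)
  then have lt: "card (insert ?z ?W) < card J"
    using assms(2) by (simp add: card_insert_if)
  have fin: "finite (insert ?z ?W)"
    by simp
  obtain c where c: "\<exists>j\<in>J. \<not> int p dvd c j"
    "\<forall>z \<in> insert ?z ?W. int p dvd (\<Sum>j\<in>J. c j * f j z)"
    using nontrivial_relation_mod[OF assms(1) fin lt assms(3), of f] by blast
  let ?F = "\<lambda>x. \<Sum>j\<in>J. c j * f j x"
  have F: "?F x = ?F ?z + (\<Sum>k=1..n. ?F (?z(k := x k)) - ?F ?z)" for x
    by (rule separable_sum[OF sep, unfolded separable_def, THEN spec])
  show ?thesis
  proof (intro exI[of _ c] conjI ballI c(1))
    fix x assume x: "x \<in> {1..n} \<rightarrow> {0..<q}"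
    have "?z(k := x k) \<in> insert ?z ?W" if "k \<in> {1..n}" for k
    proof (cases "x k = 0")
      case True
      then have "?z(k := x k) = ?z" by auto
      then show ?thesis by simp
    next
      case False
      then have "(k, x k) \<in> {1..n} \<times> {1..<q}"
        using x that by auto
      then show ?thesis
        by (intro insertI2 image_eqI[where x = "(k, x k)"]) auto
    qed
    then have "int p dvd ?F ?z + (\<Sum>k=1..n. ?F (?z(k := x k)) - ?F ?z)"
      by (intro dvd_add dvd_sum dvd_diff bspec[OF c(2)]) auto
    then show "int p dvd ?F x"
      by (subst F)
  qed
qed

lemma letter_count_mod:
  fixes n q p lam :: nat
  assumes "q > 1" "prime p" "H \<subseteq> {1..n} \<rightarrow> {0..<q}" "\<not> p dvd lam"
    and "finite H" "card H = n * (q - 1) + 1"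
    and dist: "\<And>h g. h \<in> H \<Longrightarrow> g \<in> H \<Longrightarrow> h \<noteq> g \<Longrightarrow> [hamming_dist n h g = lam] (mod p)"
    and "i \<in> {1..n}" "a < q"
  shows "[int (card {h \<in> H. h i = a}) = int lam] (mod int p)"
proof -
  define f where "f h x = int lam - int (hamming_dist n h x)" for h x :: "nat \<Rightarrow> nat"
  define e :: "(nat \<Rightarrow> nat) \<Rightarrow> int" where "e x = of_bool (x i = a)" for x
  \<comment> \<open>\<open>None\<close> indexes the letter indicator \<open>e\<close>,
    \<open>Some h\<close> the function \<open>f h\<close>: one function more than the
    dimension.\<close>
  let ?J = "insert None (Some ` H)"
  let ?f = "case_option e f"
  have card: "finite ?J" "card ?J > n * (q - 1) + 1"
    using assms(5,6) by (simp_all add: card_image card_insert_if image_iff)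
  have sep: "separable n (?f j)" for j
    using separable_letter_indicator[OF \<open>i \<in> {1..n}\<close>] separable_hamming_dist
    by (cases j) (simp_all add: e_def[abs_def] f_def[abs_def])
  obtain c where c: "\<exists>j\<in>?J. \<not> int p dvd c j"
    "\<forall>x \<in> {1..n} \<rightarrow> {0..<q}. int p dvd (\<Sum>j\<in>?J. c j * ?f j x)"
    using separable_relation_mod[where f = ?f, OF card prime_gt_1_nat[OF assms(2)] sep] by blast
  have p: "prime (int p)" "\<not> int p dvd int lam"
    using assms by auto
  have rel: "int p dvd c None * e x + (\<Sum>h\<in>H. c (Some h) * f h x)"
    if "x \<in> {1..n} \<rightarrow> {0..<q}" for x
    using bspec[OF c(2) that] \<open>finite H\<close> by (simp add: sum.reindex)
  \<comment> \<open>At the word \<open>g\<close> all other \<open>f h\<close> vanish modulo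
    \<open>p\<close>, while \<open>f g g = int lam\<close>.\<close>
  have coeff: "int p dvd c None * e g + c (Some g) * int lam" if "g \<in> H" for g
  proof -
    have "int p dvd c (Some h) * f h g" if "h \<in> H - {g}" for h
    proof -
      have "[hamming_dist n h g = lam] (mod p)"
        using dist that \<open>g \<in> H\<close> by auto
      then have "int p dvd f h g"
        unfolding f_def by (metis cong_int_iff cong_iff_dvd_diff cong_sym)
      then show ?thesis by simp
    qed
    then have "int p dvd (\<Sum>h\<in>H - {g}. c (Some h) * f h g)"
      by (rule dvd_sum)
    moreover have "int p dvd c None * e g + (\<Sum>h\<in>H. c (Some h) * f h g)"
      using rel assms(3) that by auto
    moreover have "(\<Sum>h\<in>H. c (Some h) * f h g) =
        c (Some g) * int lam + (\<Sum>h\<in>H - {g}. c (Some h) * f h g)"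
      using \<open>finite H\<close> that by (simp add: sum.remove f_def hamming_dist_def)
    ultimately show ?thesis
      by (simp only: dvd_add_left_iff flip: add.assoc)
  qed
  have c0: "\<not> int p dvd c None"
  proof
    assume c0: "int p dvd c None"
    then have "int p dvd c (Some g)" if "g \<in> H" for g
      using coeff[OF that] p by (metis dvd_add_right_iff dvd_mult2 prime_dvd_mult_iff)
    with c0 c(1) show False by auto
  qed
  have key: "int p dvd int lam * e x - (\<Sum>h\<in>H. e h * f h x)"
    if x: "x \<in> {1..n} \<rightarrow> {0..<q}" for x
  proof -
    \<comment> \<open>Multiply the relation by \<open>lam\<close> and eliminate each
      \<open>c (Some h) * int lam\<close> by \<open>coeff\<close>; the factor \<open>c None\<close>
      then cancels because \<open>p\<close> is prime.\<close>
    have "c None * (int lam * e x - (\<Sum>h\<in>H. e h * f h x)) =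
        int lam * (c None * e x + (\<Sum>h\<in>H. c (Some h) * f h x)) -
        (\<Sum>h\<in>H. (c None * e h + c (Some h) * int lam) * f h x)"
      by (simp add: algebra_simps sum_distrib_left sum.distrib)
    also have "int p dvd \<dots>"
      by (intro dvd_diff dvd_mult[OF rel[OF x]] dvd_sum dvd_mult2 coeff)
    finally show ?thesis
      using p c0 by (simp add: prime_dvd_mult_iff)
  qed
  \<comment> \<open>A second letter, available since \<open>q > 1\<close>.\<close>
  define b where "b = (if a = 0 then 1 else 0 :: nat)"
  have b: "b \<noteq> a" "b < q"
    using assms by (auto simp: b_def)
  define x where "x = (\<lambda>_::nat. 0::nat)(i := a)"
  define y where "y = x(i := b)"
  have "int p dvd (int lam * e x - (\<Sum>h\<in>H. e h * f h x)) - (int lam * e y - (\<Sum>h\<in>H. e h * f h y))"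
    using assms b by (intro dvd_diff key) (auto simp: x_def y_def)
  also have "\<dots> = int lam - (\<Sum>h\<in>H. e h * (f h x - f h y))"
    using b by (simp add: e_def x_def y_def right_diff_distrib sum_subtractf)
  also have "(\<Sum>h\<in>H. e h * (f h x - f h y)) = (\<Sum>h\<in>H. of_bool (h i = a))"
  proof (rule sum.cong)
    fix h
    \<comment> \<open>The difference is 1 if \<open>h i = a\<close> and -1 if
      \<open>h i = b\<close>; the factor \<open>e h\<close> keeps only the first case.\<close>
    have "f h x - f h y = of_bool (h i \<noteq> b) - of_bool (h i \<noteq> a)"
      using hamming_dist_fun_upd[OF \<open>i \<in> {1..n}\<close>, of h x b] by (simp add: f_def y_def x_def)
    then show "e h * (f h x - f h y) = of_bool (h i = a)"
      using b by (simp add: e_def)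
  qed simp
  finally show ?thesis
    using \<open>finite H\<close> by (simp add: int_card_Collect cong_iff_dvd_diff dvd_diff_commute)
qed

theorem theorem3:
  fixes n q p lam :: nat
    and H :: "(nat \<Rightarrow> nat) set"
  assumes "n > 0"
    and "q > 1"
    and "prime p"
    and "p \<ge> q"
    and "\<not> [n = 0] (mod p)"
    and "H \<subseteq> ({1..n} \<rightarrow>\<^sub>E {0..<q})"
    and "lam > 0"
    and "\<not> [lam = 0] (mod p)"
    and "\<And>h g. h \<in> H \<Longrightarrow> g \<in> H \<Longrightarrow> h \<noteq> g \<Longrightarrow> [hamming_dist n h g = lam] (mod p)"
    and "\<not> [q * lam = n * (q - 1) + 1] (mod p)"
  shows "card H \<le> n * (q - 1)"
proof (rule ccontr)
  assume "\<not> card H \<le> n * (q - 1)"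
  \<comment> \<open>The letter counts need exactly this many words, and the hypotheses pass to
    subsets.\<close>
  then obtain K where K: "K \<subseteq> H" "card K = n * (q - 1) + 1" "finite K"
    using obtain_subset_with_card_n[of "n * (q - 1) + 1" H] by auto
  have words: "K \<subseteq> {1..n} \<rightarrow> {0..<q}"
    using K assms(6) by (auto simp: PiE_def)
  \<comment> \<open>Any fixed position would serve; position 1 exists because
    \<open>n > 0\<close>.\<close>
  have count: "[int (card {h \<in> K. h 1 = a}) = int lam] (mod int p)" if "a < q" for a
  proof (rule letter_count_mod[where n = n and q = q])
    show "\<not> p dvd lam"
      using assms(8) by (simp add: cong_0_iff)
    show "[hamming_dist n h g = lam] (mod p)" if "h \<in> K" "g \<in> K" "h \<noteq> g" for h g
      using assms(9) that K(1) by blast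
  qed (use assms(1-3) K words that in auto)
  have "int (card K) = (\<Sum>h\<in>K. \<Sum>a<q. of_bool (h 1 = a))"
  proof -
    have "(\<Sum>a<q. of_bool (h 1 = a)) = (1::int)" if "h \<in> K" for h
    proof -
      have "h 1 < q" using words that assms(1) by (auto simp: Pi_iff)
      then show ?thesis by (simp add: of_bool_def)
    qed
    then show ?thesis by simp
  qed
  also have "\<dots> = (\<Sum>a<q. int (card {h \<in> K. h 1 = a}))"
    using K by (subst sum.swap) (simp add: int_card_Collect)
  also have "[\<dots> = (\<Sum>a<q. int lam)] (mod int p)"
    using count by (intro cong_sum) auto
  finally have "[int (n * (q - 1) + 1) = int (q * lam)] (mod int p)"
    using K by simp
  then have "[q * lam = n * (q - 1) + 1] (mod p)"
    using cong_int_iff cong_sym by blast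
  with assms(10) show False by blast
qed

end
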